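(* Let $G$ be a finite group. The following are equivalent: (a) $\mathcal{P}_e(G)$ is a split graph; (b) $\mathcal{P}_e(G)$ is a threshold graph; (c) $\mathcal{P}_e(G)$ is $2K_2$-free; (d) $G$ is a cyclic group, a dihedral group, or an elementary abelian $2$-group.
   Context: For a finite group $G$, the enhanced power graph $\mathcal{P}_e(G)$ is the simple graph with vertex set $G$ in which two distinct vertices $x,y$ are adjacent if and only if the subgroup $\langle x,y\rangle$ is cyclic. A graph is $\Gamma$-free if it has no induced subgraph isomorphic to $\Gamma$; $2K_2$ is the disjoint union of two copies of the complete graph $K_2$. A split graph is a graph whose vertex set is a disjoint union of a set inducing a complete graph and a set inducing an edgeless graph. A threshold graph is a graph that can be built from the one-vertex graph by repeatedly adding an isolated vertex or a vertex adjacent to all existing vertices. The dihedral group $D_{2n}$ of order $2n$ is $\langle a,b : a^n=b^2=e,\ bab=a^{-1}\rangle$. An elementary abelian $2$-group is a group isomorphic to $\mathbb{Z}_2^m$ for some $m$. *)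

theory Defs
  imports
    "HOL-Algebra.Product_Groups"
    "Graph_Theory.Graph_Theory"
begin

section \<open>Graphs\<close>

text \<open>
  A simple graph is represented, as in the library, by a symmetric loopfree digraph: each edge
  contributes both of its orientations.
\<close>

definition enhanced_power_graph :: "('a, 'b) monoid_scheme \<Rightarrow> 'a pair_pre_digraph" where
  "enhanced_power_graph G =
     \<lparr> pverts = carrier G,
       parcs = {(x, y). x \<in> carrier G \<and> y \<in> carrier G \<and> x \<noteq> y
                        \<and> cyclic_group (subgroup_generated G {x, y})} \<rparr>"

lemma pair_graph_enhanced_power_graph:
  assumes "finite (carrier G)"
  shows "pair_graph (enhanced_power_graph G)"
proof -
  have "parcs (enhanced_power_graph G) \<subseteq> carrier G \<times> carrier G"
    by (auto simp: enhanced_power_graph_def)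
  then have "finite (parcs (enhanced_power_graph G))"
    using assms by (meson finite_SigmaI finite_subset)
  then show ?thesis
    using assms
    by unfold_locales
      (auto simp: enhanced_power_graph_def symmetric_def insert_commute intro!: symI)
qed

definition graph_free :: "'a pair_pre_digraph \<Rightarrow> 'c pair_pre_digraph \<Rightarrow> bool" where
  "graph_free P \<Gamma> \<longleftrightarrow>
     \<not> (\<exists>H. induced_subgraph H (with_proj P) \<and> digraph_iso H (with_proj \<Gamma>))"

definition two_K2 :: "nat pair_pre_digraph" where
  "two_K2 = \<lparr> pverts = {0, 1, 2, 3}, parcs = {(0, 1), (1, 0), (2, 3), (3, 2)} \<rparr>"

definition split_graph :: "'a pair_pre_digraph \<Rightarrow> bool" where
  "split_graph P \<longleftrightarrow>
     (\<exists>A B. pverts P = A \<union> B \<and> A \<inter> B = {}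
        \<and> complete_digraph (card A) (with_proj P \<restriction> A)
        \<and> arcs (with_proj P \<restriction> B) = {})"

inductive threshold_graph :: "'a pair_pre_digraph \<Rightarrow> bool" where
  one_vertex: "threshold_graph \<lparr> pverts = {v}, parcs = {} \<rparr>"
| add_isolated:
    "threshold_graph P \<Longrightarrow> v \<notin> pverts P \<Longrightarrow>
     threshold_graph \<lparr> pverts = insert v (pverts P), parcs = parcs P \<rparr>"
| add_dominating:
    "threshold_graph P \<Longrightarrow> v \<notin> pverts P \<Longrightarrow>
     threshold_graph
       \<lparr> pverts = insert v (pverts P),
         parcs = parcs P \<union> {v} \<times> pverts P \<union> pverts P \<times> {v} \<rparr>"


section \<open>Groups given by generators and relations\<close>

text \<open>
  A letter \<open>(x, True)\<close> stands for the generator \<open>x\<close> and \<open>(x, False)\<close> for its formal inverse.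
  A pair of words \<open>(u, v)\<close> in \<open>R\<close> is the relation \<open>u = v\<close>. Every element of the type \<open>'x\<close> is a
  generator.
\<close>

type_synonym 'x group_word = "('x \<times> bool) list"

inductive word_cong :: "('x group_word \<times> 'x group_word) set \<Rightarrow> 'x group_word \<Rightarrow> 'x group_word \<Rightarrow> bool"
  for R where
  refl: "word_cong R u u"
| sym: "word_cong R u v \<Longrightarrow> word_cong R v u"
| trans: "word_cong R u v \<Longrightarrow> word_cong R v w \<Longrightarrow> word_cong R u w"
| append: "word_cong R u u' \<Longrightarrow> word_cong R v v' \<Longrightarrow> word_cong R (u @ v) (u' @ v')"
| cancel: "word_cong R [(x, s), (x, \<not> s)] []"
| relation: "(u, v) \<in> R \<Longrightarrow> word_cong R u v"

definition word_class :: "('x group_word \<times> 'x group_word) set \<Rightarrow> 'x group_word \<Rightarrow> 'x group_word set" where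
  "word_class R u = {v. word_cong R u v}"

definition presented_group :: "('x group_word \<times> 'x group_word) set \<Rightarrow> 'x group_word set monoid" where
  "presented_group R =
     \<lparr> carrier = range (word_class R),
       monoid.mult = (\<lambda>U V. {w. \<exists>u\<in>U. \<exists>v\<in>V. word_cong R (u @ v) w}),
       one = word_class R [] \<rparr>"

lemma word_class_eq_iff: "word_class R u = word_class R v \<longleftrightarrow> word_cong R u v"
  unfolding word_class_def by (blast intro: word_cong.refl word_cong.sym word_cong.trans)

lemma mult_presented_group:
  "word_class R u \<otimes>\<^bsub>presented_group R\<^esub> word_class R v = word_class R (u @ v)"
  unfolding presented_group_def word_class_def
  by (auto intro: word_cong.refl word_cong.trans word_cong.append)

lemma word_cong_inverse: "word_cong R (rev (map (\<lambda>(x, s). (x, \<not> s)) w) @ w) []"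
proof (induction w)
  case Nil
  show ?case by (simp add: word_cong.refl)
next
  case (Cons l w)
  obtain x s where l: "l = (x, s)" by fastforce
  let ?i = "rev (map (\<lambda>(x, s). (x, \<not> s)) w)"
  have "word_cong R [(x, \<not> s), (x, s)] []"
    using word_cong.cancel[of R x "\<not> s"] by simp
  then have "word_cong R (?i @ ([(x, \<not> s), (x, s)] @ w)) (?i @ ([] @ w))"
    by (intro word_cong.append word_cong.refl)
  with Cons show ?case
    by (auto simp: l intro: word_cong.trans)
qed

lemma group_presented_group: "Group.group (presented_group R)"
proof (rule groupI)
  fix X assume "X \<in> carrier (presented_group R)"
  then obtain w where "X = word_class R w" by (auto simp: presented_group_def)
  then have "word_class R (rev (map (\<lambda>(x, s). (x, \<not> s)) w)) \<otimes>\<^bsub>presented_group R\<^esub> X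
               = \<one>\<^bsub>presented_group R\<^esub>"
    using word_cong_inverse[of R w]
    by (simp only: mult_presented_group) (simp add: presented_group_def word_class_eq_iff)
  then show "\<exists>Y\<in>carrier (presented_group R). Y \<otimes>\<^bsub>presented_group R\<^esub> X = \<one>\<^bsub>presented_group R\<^esub>"
    by (auto simp: presented_group_def)
next
  fix X Y assume "X \<in> carrier (presented_group R)" "Y \<in> carrier (presented_group R)"
  then obtain u v where uv: "X = word_class R u" "Y = word_class R v"
    by (auto simp: presented_group_def)
  show "X \<otimes>\<^bsub>presented_group R\<^esub> Y \<in> carrier (presented_group R)"
    unfolding uv mult_presented_group by (simp add: presented_group_def)
next
  fix X Y Z
  assume "X \<in> carrier (presented_group R)" "Y \<in> carrier (presented_group R)"
    "Z \<in> carrier (presented_group R)"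
  then obtain u v w where uvw: "X = word_class R u" "Y = word_class R v" "Z = word_class R w"
    by (auto simp: presented_group_def)
  show "X \<otimes>\<^bsub>presented_group R\<^esub> Y \<otimes>\<^bsub>presented_group R\<^esub> Z
          = X \<otimes>\<^bsub>presented_group R\<^esub> (Y \<otimes>\<^bsub>presented_group R\<^esub> Z)"
    unfolding uvw mult_presented_group by simp
next
  show "\<one>\<^bsub>presented_group R\<^esub> \<in> carrier (presented_group R)"
    by (simp add: presented_group_def)
next
  fix X assume "X \<in> carrier (presented_group R)"
  then obtain w where w: "X = word_class R w" by (auto simp: presented_group_def)
  have one: "\<one>\<^bsub>presented_group R\<^esub> = word_class R []" by (simp add: presented_group_def)
  show "\<one>\<^bsub>presented_group R\<^esub> \<otimes>\<^bsub>presented_group R\<^esub> X = X"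
    unfolding one w mult_presented_group by simp
qed


section \<open>Dihedral groups and elementary abelian 2-groups\<close>

datatype dihedral_generator = gen_a | gen_b

definition dihedral_relations :: "nat \<Rightarrow> (dihedral_generator group_word \<times> dihedral_generator group_word) set" where
  "dihedral_relations n =
     {(replicate n (gen_a, True), []),
      ([(gen_b, True), (gen_b, True)], []),
      ([(gen_b, True), (gen_a, True), (gen_b, True)], [(gen_a, False)])}"

text \<open>The index \<open>n\<close> is half of the order: this is the group usually written \<open>D\<^sub>2\<^sub>n\<close>.\<close>

definition dihedral_group :: "nat \<Rightarrow> dihedral_generator group_word set monoid" where
  "dihedral_group n = presented_group (dihedral_relations n)"

text \<open>
  For \<open>n = 0\<close> the presentation defines the infinite dihedral group, which is excluded. The
  degenerate values \<open>n = 1\<close> and \<open>n = 2\<close> (groups of order 2 and 4) are allowed.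
\<close>

definition is_dihedral_group :: "('a, 'b) monoid_scheme \<Rightarrow> bool" where
  "is_dihedral_group G \<longleftrightarrow> (\<exists>n\<ge>1. G \<cong> dihedral_group n)"

definition elementary_abelian_2_group :: "('a, 'b) monoid_scheme \<Rightarrow> bool" where
  "elementary_abelian_2_group G \<longleftrightarrow>
     (\<exists>m::nat. G \<cong> product_group {..<m} (\<lambda>_. integer_mod_group 2))"

end

theory Submission
  imports Defs "HOL-Algebra.Multiplicative_Group"
begin

text \<open>
  Everything hinges on one condition: some cyclic subgroup \<open>A\<close> contains all elements that do not
  square to the identity. If it fails, take \<open>a\<close> of maximal order and \<open>x\<close> outside \<open>\<langle>a\<rangle>\<close>
  with \<open>x\<^sup>2 \<noteq> e\<close>; by maximality no cyclic subgroup contains both, so the edges \<open>{a, a\<inverse>}\<close> and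
  \<open>{x, x\<inverse>}\<close> induce \<open>2K\<^sub>2\<close>. If it holds, the graph is the clique \<open>A\<close> with every further vertex
  attached to \<open>e\<close> alone, which is both split and threshold. On the group side, when \<open>A = \<langle>a\<rangle>\<close>
  with \<open>a\<^sup>2 \<noteq> e\<close>, each element outside \<open>A\<close> is an involution inverting \<open>a\<close>, so the product of
  two such elements centralises \<open>a\<close> and lies in \<open>A\<close>: the index of \<open>A\<close> is at most 2 and the
  group is cyclic or dihedral. Otherwise all elements square to \<open>e\<close>.
\<close>

section \<open>Split and threshold graphs\<close>

text \<open>An induced \<open>two_K2\<close>, expressed by four vertices of the host graph. One
  orientation of each pair suffices once arcs are symmetric.\<close>

definition contains_2K2 :: "'a pair_pre_digraph \<Rightarrow> bool" where
  "contains_2K2 P \<longleftrightarrow>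
     (\<exists>a b c d. distinct [a, b, c, d] \<and> (a, b) \<in> parcs P \<and> (c, d) \<in> parcs P
        \<and> (a, c) \<notin> parcs P \<and> (a, d) \<notin> parcs P \<and> (b, c) \<notin> parcs P \<and> (b, d) \<notin> parcs P)"

lemma contains_2K2_if_induced:
  assumes ind: "induced_subgraph H (with_proj P)" and iso: "digraph_iso H (with_proj two_K2)"
  shows "contains_2K2 P"
proof -
  have H: "arcs H = {e \<in> parcs P. fst e \<in> verts H \<and> snd e \<in> verts H}" "tail H = fst" "head H = snd"
    using ind by (auto simp: induced_subgraph_def subgraph_def compatible_def)
  obtain f where f: "pre_digraph.digraph_isomorphism H f" and eq: "with_proj two_K2 = app_iso f H"
    using iso by (auto simp: digraph_iso_def)
  have arcs: "{(0, 1), (1, 0), (2, 3), (3, 2)} = iso_arcs f ` arcs H"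
    and tail: "iso_tail f = fst" and head: "iso_head f = snd"
    using arg_cong[OF eq, of arcs] arg_cong[OF eq, of tail] arg_cong[OF eq, of head]
    by (simp_all add: two_K2_def)
  \<comment> \<open>An isomorphism carries separate maps on vertices and on arcs. As tails and heads
    are \<open>fst\<close> and \<open>snd\<close> on both sides, the arc map has to be the vertex
    map on each component.\<close>
  have pres: "iso_arcs f (x, y) = (iso_verts f x, iso_verts f y)" if "(x, y) \<in> arcs H" for x y
    using f that by (intro prod_eqI) (auto simp: pre_digraph.digraph_isomorphism_def H tail head)
  have pull: "\<exists>x y. (x, y) \<in> arcs H \<and> iso_verts f x = i \<and> iso_verts f y = j"
    if "(i, j) \<in> {(0, 1), (1, 0), (2, 3), (3, 2)}" for i j
    using that unfolding arcs by (fastforce simp: pres)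
  obtain a b where ab: "(a, b) \<in> arcs H" "iso_verts f a = 0" "iso_verts f b = 1"
    using pull[of 0 1] by auto
  obtain c d where cd: "(c, d) \<in> arcs H" "iso_verts f c = 2" "iso_verts f d = 3"
    using pull[of 2 3] by auto
  \<comment> \<open>An arc between the two pairs would belong to the induced \<open>H\<close>, and
    its image would join \<open>{0, 1}\<close> to \<open>{2, 3}\<close>.\<close>
  have nonadj: "(x, y) \<notin> parcs P"
    if "x \<in> {a, b}" "y \<in> {c, d}" for x y
  proof
    assume "(x, y) \<in> parcs P"
    then have *: "(x, y) \<in> arcs H" using that ab(1) cd(1) by (auto simp: H)
    have "iso_arcs f (x, y) \<in> {(0, 1), (1, 0), (2, 3), (3, 2)}"
      unfolding arcs using * by blast
    then show False unfolding pres[OF *] using that ab cd by auto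
  qed
  have "distinct [a, b, c, d]" using ab(2,3) cd(2,3) by auto
  moreover have "(a, b) \<in> parcs P" "(c, d) \<in> parcs P" using ab cd by (auto simp: H)
  ultimately show ?thesis unfolding contains_2K2_def using nonadj by blast
qed

lemma induced_if_contains_2K2:
  assumes P: "pair_graph P" and c: "contains_2K2 P"
  shows "\<exists>H. induced_subgraph H (with_proj P) \<and> digraph_iso H (with_proj two_K2)"
proof -
  interpret pair_graph P by (rule P)
  have sym: "(y, x) \<in> parcs P \<longleftrightarrow> (x, y) \<in> parcs P" for x y
    using sym_arcs by (auto simp: symmetric_def dest: symD)
  obtain a b c d where dist: "distinct [a, b, c, d]" and ab: "(a, b) \<in> parcs P" "(c, d) \<in> parcs P"
    and non: "(a, c) \<notin> parcs P" "(a, d) \<notin> parcs P" "(b, c) \<notin> parcs P" "(b, d) \<notin> parcs P"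
    using c unfolding contains_2K2_def by blast
  have irr: "(x, x) \<notin> parcs P" for x
    using no_loops[of "(x, x)"] by auto
  have V: "a \<in> pverts P" "b \<in> pverts P" "c \<in> pverts P" "d \<in> pverts P"
    using ab wellformed[of "(a, b)"] wellformed[of "(c, d)"] by auto
  define H where "H = \<lparr> pverts = {a, b, c, d}, parcs = {(a, b), (b, a), (c, d), (d, c)} \<rparr>"
  have wf: "wf_digraph (with_proj H)"
    by unfold_locales (auto simp: H_def)
  have ind: "induced_subgraph (with_proj H) (with_proj P)"
  proof -
    have "(b, a) \<in> parcs P" "(d, c) \<in> parcs P"
      "(c, a) \<notin> parcs P" "(d, a) \<notin> parcs P" "(c, b) \<notin> parcs P" "(d, b) \<notin> parcs P"
      using ab non by (simp_all add: sym)
    then show ?thesis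
      using V ab non irr wf wf_digraph
      by (auto simp: induced_subgraph_def subgraph_def compatible_def H_def)
  qed
  \<comment> \<open>The default 3 is the value meant for \<open>d\<close>; only the four vertices of
    \<open>H\<close> matter.\<close>
  define v where "v x = (if x = a then 0 else if x = b then 1 else if x = c then 2 else (3::nat))" for x
  have v: "v a = 0" "v b = 1" "v c = 2" "v d = 3"
    using dist by (auto simp: v_def)
  define f where "f = \<lparr> iso_verts = v, iso_arcs = map_prod v v, iso_head = snd, iso_tail = fst \<rparr>"
  have "pre_digraph.digraph_isomorphism (with_proj H) f"
    using wf dist by (auto simp: pre_digraph.digraph_isomorphism_def f_def H_def inj_on_def v)
  moreover have "with_proj two_K2 = app_iso f (with_proj H)"
    by (simp add: app_iso_def f_def H_def with_proj_def two_K2_def v)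
  ultimately have "digraph_iso (with_proj H) (with_proj two_K2)"
    unfolding digraph_iso_def by blast
  with ind show ?thesis by blast
qed

lemma graph_free_two_K2_iff:
  assumes "pair_graph P"
  shows "graph_free P two_K2 \<longleftrightarrow> \<not> contains_2K2 P"
  unfolding graph_free_def using contains_2K2_if_induced induced_if_contains_2K2[OF assms] by metis

text \<open>A new isolated vertex lies on no edge, and a new dominating vertex is adjacent to the
  ends of the other edge, so neither belongs to an induced \<open>two_K2\<close>. The bound on
  \<open>parcs\<close> strengthens the induction: no old arc can touch the new vertex.\<close>

lemma threshold_graph_no_2K2:
  assumes "threshold_graph P"
  shows "parcs P \<subseteq> pverts P \<times> pverts P \<and> \<not> contains_2K2 P"
  using assms
proof induction
  case (one_vertex v)
  then show ?case by (simp add: contains_2K2_def)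
next
  case (add_isolated P v)
  then show ?case by (auto simp: contains_2K2_def)
next
  case (add_dominating P v)
  let ?Q = "\<lparr> pverts = insert v (pverts P),
              parcs = parcs P \<union> {v} \<times> pverts P \<union> pverts P \<times> {v} \<rparr>"
  have "\<not> contains_2K2 ?Q"
  proof
    assume "contains_2K2 ?Q"
    then obtain a b c d where *: "distinct [a, b, c, d]"
      "(a, b) \<in> parcs ?Q" "(c, d) \<in> parcs ?Q" "(a, c) \<notin> parcs ?Q" "(a, d) \<notin> parcs ?Q"
      "(b, c) \<notin> parcs ?Q" "(b, d) \<notin> parcs ?Q"
      unfolding contains_2K2_def by (elim exE conjE) (rule that)
    then have "a \<noteq> v" "b \<noteq> v" "c \<noteq> v" "d \<noteq> v"
      using add_dominating by auto
    with * have "contains_2K2 P"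
      unfolding contains_2K2_def by auto
    then show False using add_dominating by blast
  qed
  then show ?case using add_dominating by auto
qed

lemma split_graph_iff:
  assumes P: "pair_graph P"
  shows "split_graph P \<longleftrightarrow>
    (\<exists>A\<subseteq>pverts P. (\<forall>x\<in>A. \<forall>y\<in>A. x \<noteq> y \<longrightarrow> (x, y) \<in> parcs P)
                 \<and> (\<forall>x\<in>pverts P - A. \<forall>y\<in>pverts P - A. (x, y) \<notin> parcs P))"
proof -
  interpret pair_graph P by (rule P)
  have irr: "(x, x) \<notin> parcs P" for x
    using no_loops[of "(x, x)"] by auto
  have clique: "complete_digraph (card A) (with_proj P \<restriction> A) \<longleftrightarrow>
      (\<forall>x\<in>A. \<forall>y\<in>A. x \<noteq> y \<longrightarrow> (x, y) \<in> parcs P)" if "A \<subseteq> pverts P" for A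
  proof -
    have "with_proj P \<restriction> A = with_proj \<lparr> pverts = A, parcs = parcs P \<inter> A \<times> A \<rparr>"
      by (auto simp: induce_subgraph_def with_proj_def)
    then have "complete_digraph (card A) (with_proj P \<restriction> A) \<longleftrightarrow>
        finite A \<and> parcs P \<inter> A \<times> A = {(u, v). u \<in> A \<and> v \<in> A \<and> u \<noteq> v}"
      by (simp add: complete_digraph_pair_def)
    moreover have "finite A"
      using that by (rule finite_subset) simp
    ultimately show ?thesis
      using irr by auto
  qed
  have indep: "arcs (with_proj P \<restriction> B) = {} \<longleftrightarrow> (\<forall>x\<in>B. \<forall>y\<in>B. (x, y) \<notin> parcs P)" for B
    by (auto simp: induce_subgraph_def)
  \<comment> \<open>The second part of a partition is the complement of the first, which leaves one
    set to quantify over.\<close>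
  have exchange: "(\<exists>A B. pverts P = A \<union> B \<and> A \<inter> B = {} \<and> Q A \<and> R B)
       \<longleftrightarrow> (\<exists>A\<subseteq>pverts P. Q A \<and> R (pverts P - A))" for Q R
  proof
    assume "\<exists>A B. pverts P = A \<union> B \<and> A \<inter> B = {} \<and> Q A \<and> R B"
    then obtain A B where "pverts P = A \<union> B" "A \<inter> B = {}" "Q A" "R B" by blast
    moreover from this have "B = pverts P - A" by blast
    ultimately show "\<exists>A\<subseteq>pverts P. Q A \<and> R (pverts P - A)" by blast
  next
    assume "\<exists>A\<subseteq>pverts P. Q A \<and> R (pverts P - A)"
    then obtain A where "A \<subseteq> pverts P" "Q A" "R (pverts P - A)" by blast
    then show "\<exists>A B. pverts P = A \<union> B \<and> A \<inter> B = {} \<and> Q A \<and> R B"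
      by (intro exI[of _ A] exI[of _ "pverts P - A"]) auto
  qed
  have "split_graph P \<longleftrightarrow> (\<exists>A\<subseteq>pverts P. complete_digraph (card A) (with_proj P \<restriction> A)
      \<and> arcs (with_proj P \<restriction> (pverts P - A)) = {})"
    unfolding split_graph_def by (rule exchange)
  then show ?thesis
    unfolding indep by (simp only: clique cong: conj_cong)
qed

text \<open>The vertices off the clique are independent, so both edges of a \<open>two_K2\<close>
  have an endpoint in the clique, and these two endpoints would be adjacent.\<close>

lemma split_graph_no_2K2:
  assumes P: "pair_graph P" and split: "split_graph P"
  shows "\<not> contains_2K2 P"
proof
  interpret pair_graph P by (rule P)
  obtain A where
    clique: "\<forall>x\<in>A. \<forall>y\<in>A. x \<noteq> y \<longrightarrow> (x, y) \<in> parcs P" and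
    indep: "\<forall>x\<in>pverts P - A. \<forall>y\<in>pverts P - A. (x, y) \<notin> parcs P"
    using split unfolding split_graph_iff[OF P] by auto
  assume "contains_2K2 P"
  then obtain a b c d where dist: "distinct [a, b, c, d]"
    and edges: "(a, b) \<in> parcs P" "(c, d) \<in> parcs P"
    and non: "(a, c) \<notin> parcs P" "(a, d) \<notin> parcs P" "(b, c) \<notin> parcs P" "(b, d) \<notin> parcs P"
    unfolding contains_2K2_def by blast
  have "a \<in> A \<or> b \<in> A" "c \<in> A \<or> d \<in> A"
    using edges indep wellformed[of "(a, b)"] wellformed[of "(c, d)"] by auto
  then show False
    using non clique dist by auto
qed

lemma threshold_graph_clique:
  assumes "finite A" "A \<noteq> {}"
  shows "threshold_graph \<lparr> pverts = A, parcs = {(x, y). x \<in> A \<and> y \<in> A \<and> x \<noteq> y} \<rparr>"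
  using assms
proof (induction rule: finite_ne_induct)
  case (singleton v)
  have "{(x, y). x \<in> {v} \<and> y \<in> {v} \<and> x \<noteq> y} = {}" by auto
  then show ?case by (simp only: threshold_graph.one_vertex)
next
  case (insert v A)
  have "{(x, y). x \<in> insert v A \<and> y \<in> insert v A \<and> x \<noteq> y} =
      {(x, y). x \<in> A \<and> y \<in> A \<and> x \<noteq> y} \<union> {v} \<times> A \<union> A \<times> {v}"
    using insert.hyps by auto
  then show ?case using threshold_graph.add_dominating[OF insert.IH, of v] insert.hyps by simp
qed

lemma threshold_graph_add_isolated_set:
  assumes "threshold_graph P" "finite B" "B \<inter> pverts P = {}"
  shows "threshold_graph \<lparr> pverts = B \<union> pverts P, parcs = parcs P \<rparr>"
  using assms(2,3)
proof (induction rule: finite_induct)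
  case empty
  have "\<lparr> pverts = {} \<union> pverts P, parcs = parcs P \<rparr> = P" by (intro pair_pre_digraph.equality) simp_all
  then show ?case using assms(1) by (simp only:)
next
  case (insert v B)
  then show ?case using threshold_graph.add_isolated[of "\<lparr> pverts = B \<union> pverts P, parcs = parcs P \<rparr>" v] by simp
qed

text \<open>\<open>A\<close> serves as the clique of the split partition. For the threshold property
  \<open>e\<close> is added last, as a dominating vertex: without it the graph is the clique
  \<open>A - {e}\<close> together with isolated vertices.\<close>

lemma clique_with_pendants:
  assumes P: "pair_graph P" and A: "A \<subseteq> pverts P" and e: "e \<in> A"
    and adj: "\<And>x y. x \<in> pverts P \<Longrightarrow> y \<in> pverts P \<Longrightarrow> x \<noteq> y \<Longrightarrow>
       (x, y) \<in> parcs P \<longleftrightarrow> x \<in> A \<and> y \<in> A \<or> x = e \<or> y = e"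
  shows "split_graph P" "threshold_graph P"
proof -
  interpret pair_graph P by (rule P)
  have irr: "(x, x) \<notin> parcs P" for x
    using no_loops[of "(x, x)"] by auto
  show "split_graph P"
    unfolding split_graph_iff[OF P] using A e adj irr by (intro exI[of _ A]) blast
  have finA: "finite A" using A by (rule finite_subset) simp
  have arcsP: "parcs P = {(x, y). x \<in> pverts P \<and> y \<in> pverts P \<and> x \<noteq> y \<and> (x \<in> A \<and> y \<in> A \<or> x = e \<or> y = e)}"
    using adj irr wellformed by fastforce
  let ?B = "pverts P - A"
  show "threshold_graph P"
  \<comment> \<open>Threshold graphs are nonempty, so the graph without \<open>e\<close> can be
    built first only if another vertex exists.\<close>
  proof (cases "A = {e} \<and> ?B = {}")
    case True
    then have "P = \<lparr> pverts = {e}, parcs = {} \<rparr>"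
      using arcsP A by (intro pair_pre_digraph.equality) auto
    then show ?thesis by (metis threshold_graph.one_vertex)
  next
    case False
    define C where "C = A - {e}"
    let ?Q = "\<lparr> pverts = pverts P - {e}, parcs = {(x, y). x \<in> C \<and> y \<in> C \<and> x \<noteq> y} \<rparr>"
    have Q: "threshold_graph ?Q"
    proof (cases "C = {}")
      case False
      have "threshold_graph \<lparr> pverts = ?B \<union> C, parcs = {(x, y). x \<in> C \<and> y \<in> C \<and> x \<noteq> y} \<rparr>"
        using threshold_graph_add_isolated_set[OF threshold_graph_clique[OF _ False], of ?B] finA
        by (auto simp: C_def)
      moreover have "?B \<union> C = pverts P - {e}" using A e by (auto simp: C_def)
      ultimately show ?thesis by simp
    next
      case True
      then have "A = {e}" using e by (auto simp: C_def)
      \<comment> \<open>No edge remains without \<open>e\<close>, so any vertex off the clique can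
        start the construction.\<close>
      with False obtain v where v: "v \<in> ?B" by auto
      have "threshold_graph \<lparr> pverts = (?B - {v}) \<union> {v}, parcs = {} \<rparr>"
        using threshold_graph_add_isolated_set[OF threshold_graph.one_vertex[of v], of "?B - {v}"] by auto
      moreover have "(?B - {v}) \<union> {v} = pverts P - {e}" using v \<open>A = {e}\<close> by auto
      ultimately show ?thesis using True by simp
    qed
    have "P = \<lparr> pverts = insert e (pverts ?Q),
                parcs = parcs ?Q \<union> {e} \<times> pverts ?Q \<union> pverts ?Q \<times> {e} \<rparr>"
      using A e by (intro pair_pre_digraph.equality) (auto simp: arcsP C_def)
    then show ?thesis using threshold_graph.add_dominating[OF Q, of e] by simp
  qed
qed

section \<open>Cyclic subgroups and the enhanced power graph\<close>

context Group.group
begin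

lemma generate_singleton:
  assumes "z \<in> carrier G"
  shows "generate G {z} = range (\<lambda>n::int. z [^] n)"
  using carrier_subgroup_generated_by_singleton[OF assms] assms
  by (simp add: carrier_subgroup_generated)

lemma generate_self: "x \<in> generate G {x}" "\<one> \<in> generate G {x}"
  by (auto intro: generate.intros)

text \<open>Adjacency turns into lying in a common cyclic subgroup. For the converse,
  \<open>z [^] i\<close> and \<open>z [^] j\<close> generate the same subgroup as
  \<open>z [^] gcd i j\<close>: Bezout gives one inclusion, divisibility the other.\<close>

lemma cyclic_pair_iff:
  assumes x: "x \<in> carrier G" and y: "y \<in> carrier G"
  shows "cyclic_group (subgroup_generated G {x, y}) \<longleftrightarrow>
    (\<exists>z\<in>carrier G. x \<in> generate G {z} \<and> y \<in> generate G {z})"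
proof
  let ?H = "subgroup_generated G {x, y}"
  have xy: "x \<in> carrier ?H" "y \<in> carrier ?H"
    using subgroup_generated_subset_carrier_subset[of "{x, y}"] x y by auto
  assume "cyclic_group ?H"
  then obtain z where z: "z \<in> carrier ?H" "carrier ?H = range (\<lambda>n::int. z [^]\<^bsub>?H\<^esub> n)"
    using group.cyclic_group[OF group_subgroup_generated] by blast
  have zG: "z \<in> carrier G" using z(1) carrier_subgroup_generated_subset by blast
  have "carrier ?H = generate G {z}"
    unfolding generate_singleton[OF zG] using z int_pow_subgroup_generated[OF z(1)] by auto
  with xy zG show "\<exists>z\<in>carrier G. x \<in> generate G {z} \<and> y \<in> generate G {z}" by auto
next
  let ?H = "subgroup_generated G {x, y}"
  assume "\<exists>z\<in>carrier G. x \<in> generate G {z} \<and> y \<in> generate G {z}"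
  then obtain z i j where z: "z \<in> carrier G" and i: "x = z [^] (i::int)" and j: "y = z [^] (j::int)"
    by (auto simp: generate_singleton)
  obtain u v where uv: "u * i + v * j = gcd i j" using bezout_int by blast
  define w where "w = z [^] gcd i j"
  have w: "w \<in> carrier G" using z by (simp add: w_def)
  have "z [^] (u * i + v * j) = x [^] u \<otimes> y [^] v"
    using z by (simp add: i j int_pow_mult int_pow_pow mult.commute)
  then have w_eq: "w = x [^] u \<otimes> y [^] v" by (simp add: w_def uv)
  have sub: "subgroup (carrier ?H) G" by (rule subgroup_subgroup_generated)
  have "x \<in> carrier ?H" "y \<in> carrier ?H"
    using subgroup_generated_subset_carrier_subset[of "{x, y}"] x y by auto
  then have wH: "w \<in> carrier ?H"
    unfolding w_eq using sub by (intro subgroup.m_closed[OF sub] subgroup_int_pow_closed) auto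
  have "z [^] i = w [^] (i div gcd i j)" "z [^] j = w [^] (j div gcd i j)"
    using z by (simp_all add: w_def int_pow_pow)
  then have "{x, y} \<subseteq> generate G {w}" unfolding i j generate_singleton[OF w] by auto
  then have "carrier ?H \<subseteq> generate G {w}"
    using w by (intro subgroup_generated_minimal generate_is_subgroup) auto
  moreover have "generate G {w} \<subseteq> carrier ?H"
    using wH sub by (intro generate_subgroup_incl) auto
  ultimately have "carrier ?H = range (\<lambda>n::int. w [^]\<^bsub>?H\<^esub> n)"
    using int_pow_subgroup_generated[OF wH] by (simp add: generate_singleton[OF w])
  with wH show "cyclic_group ?H"
    using group.cyclic_group[OF group_subgroup_generated] by blast
qed

lemma square_eq_one_iff:
  assumes "x \<in> carrier G"
  shows "x \<otimes> x = \<one> \<longleftrightarrow> inv x = x"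
  using assms by (metis inv_equality r_inv)

text \<open>Powers of \<open>z\<close> depend only on the parity of the exponent. The case
  \<open>z = \<one>\<close> is included.\<close>

lemma generate_involution:
  assumes "z \<in> carrier G" "z \<otimes> z = \<one>"
  shows "generate G {z} = {\<one>, z}"
proof -
  have "z [^] (2::nat) = \<one>" using assms by (simp add: numeral_2_eq_2)
  then have "z [^] n \<in> {\<one>, z}" for n :: nat
    by (cases "even n") (use assms in \<open>auto elim!: evenE oddE simp: nat_pow_pow[symmetric] nat_pow_mult[symmetric]\<close>)
  moreover have "inv z = z" using assms by (simp add: square_eq_one_iff)
  ultimately have "z [^] n \<in> {\<one>, z}" for n :: int
    using assms by (cases n rule: int_cases2) (force simp: int_pow_int int_pow_neg)+
  moreover have "\<one> \<in> generate G {z}" "z \<in> generate G {z}"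
    by (auto intro: generate.intros)
  ultimately show ?thesis
    using assms by (auto simp: generate_singleton)
qed

end

section \<open>The pivotal condition and its graph-theoretic meaning\<close>

definition involutive_off_cyclic :: "('a, 'b) monoid_scheme \<Rightarrow> bool" where
  "involutive_off_cyclic G \<longleftrightarrow>
     (\<exists>a\<in>carrier G. \<forall>x\<in>carrier G. x \<in> generate G {a} \<or> x \<otimes>\<^bsub>G\<^esub> x = \<one>\<^bsub>G\<^esub>)"

lemma enhanced_power_graph_simps:
  "pverts (enhanced_power_graph G) = carrier G"
  "(x, y) \<in> parcs (enhanced_power_graph G) \<longleftrightarrow>
     x \<in> carrier G \<and> y \<in> carrier G \<and> x \<noteq> y \<and> cyclic_group (subgroup_generated G {x, y})"
  by (auto simp: enhanced_power_graph_def)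

context Group.group
begin

text \<open>The graph has the shape treated in \<open>clique_with_pendants\<close>, with the cyclic
  subgroup as clique and \<open>\<one>\<close> as the vertex adjacent to all others.\<close>

lemma split_threshold_if_involutive_off_cyclic:
  assumes fin: "finite (carrier G)" and inv: "involutive_off_cyclic G"
  shows "split_graph (enhanced_power_graph G)" "threshold_graph (enhanced_power_graph G)"
proof -
  obtain a where a: "a \<in> carrier G"
    and off: "\<And>x. x \<in> carrier G \<Longrightarrow> x \<notin> generate G {a} \<Longrightarrow> x \<otimes> x = \<one>"
    using inv unfolding involutive_off_cyclic_def by blast
  let ?A = "generate G {a}"
  have sub: "subgroup ?A G" using a by (simp add: generate_is_subgroup)
  have adj: "(x, y) \<in> parcs (enhanced_power_graph G) \<longleftrightarrow> x \<in> ?A \<and> y \<in> ?A \<or> x = \<one> \<or> y = \<one>"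
    if x: "x \<in> carrier G" and y: "y \<in> carrier G" and "x \<noteq> y" for x y
  proof -
    \<comment> \<open>A generator \<open>z\<close> outside \<open>?A\<close> squares to
      \<open>\<one>\<close> and generates only \<open>{\<one>, z}\<close>, so one of the distinct
      elements \<open>x\<close>, \<open>y\<close> is \<open>\<one>\<close>.\<close>
    have "x \<in> ?A \<and> y \<in> ?A \<or> x = \<one> \<or> y = \<one>"
      if z: "z \<in> carrier G" "x \<in> generate G {z}" "y \<in> generate G {z}" for z
    proof (cases "z \<in> ?A")
      case True
      then have "generate G {z} \<subseteq> ?A" using sub by (simp add: generate_subgroup_incl)
      then show ?thesis using z by blast
    next
      case False
      then have "generate G {z} = {\<one>, z}" using off z(1) by (simp add: generate_involution)
      then show ?thesis using z \<open>x \<noteq> y\<close> by auto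
    qed
    then have "(\<exists>z\<in>carrier G. x \<in> generate G {z} \<and> y \<in> generate G {z}) \<longleftrightarrow>
        x \<in> ?A \<and> y \<in> ?A \<or> x = \<one> \<or> y = \<one>"
      using a x y generate_self by blast
    then show ?thesis
      using x y \<open>x \<noteq> y\<close> by (simp add: enhanced_power_graph_simps cyclic_pair_iff)
  qed
  have "?A \<subseteq> carrier G" using sub by (rule subgroup.subset)
  then show "split_graph (enhanced_power_graph G)" "threshold_graph (enhanced_power_graph G)"
    using clique_with_pendants[OF pair_graph_enhanced_power_graph[OF fin], of ?A \<one>]
      adj generate_self(2) by (simp_all add: enhanced_power_graph_simps(1))
qed

lemma involutive_off_cyclic_if_no_2K2:
  assumes fin: "finite (carrier G)" and free: "\<not> contains_2K2 (enhanced_power_graph G)"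
  shows "involutive_off_cyclic G"
proof (rule ccontr)
  assume not: "\<not> involutive_off_cyclic G"
  obtain a where a: "a \<in> carrier G" and max: "\<And>z. z \<in> carrier G \<Longrightarrow> ord z \<le> ord a"
  proof -
    have "finite (ord ` carrier G)" "ord ` carrier G \<noteq> {}" using fin by auto
    then have "Max (ord ` carrier G) \<in> ord ` carrier G" by (rule Max_in)
    then obtain a where "a \<in> carrier G" "ord a = Max (ord ` carrier G)" by auto
    then show ?thesis using that[of a] fin by simp
  qed
  obtain x where x: "x \<in> carrier G" "x \<notin> generate G {a}" "x \<otimes> x \<noteq> \<one>"
    using not a unfolding involutive_off_cyclic_def by blast
  \<comment> \<open>Otherwise maximality bounds \<open>ord x\<close> by 2. Finiteness excludes the
    value 0, which stands for infinite order, so \<open>ord x\<close> divides 2, against the choice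
    of \<open>x\<close>.\<close>
  have "a \<otimes> a \<noteq> \<one>"
  proof
    assume "a \<otimes> a = \<one>"
    then have "a [^] (2::nat) = \<one>" using a by (simp add: numeral_2_eq_2)
    then have "ord a dvd 2" using a by (simp add: pow_eq_id)
    then have "ord a \<le> 2" by (rule dvd_imp_le) simp
    then have "ord x \<le> 2" using max[OF x(1)] by simp
    moreover have "ord x \<ge> 1" using fin x(1) by (rule ord_ge_1)
    ultimately have "ord x dvd 2" by (auto simp: le_Suc_eq numeral_2_eq_2)
    then have "x [^] (2::nat) = \<one>" using x by (simp add: pow_eq_id)
    then show False using x by (simp add: numeral_2_eq_2)
  qed
  have self_adj: "(y, inv y) \<in> parcs (enhanced_power_graph G)" if "y \<in> carrier G" "y \<otimes> y \<noteq> \<one>" for y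
  proof -
    have "inv y \<in> generate G {y}" by (auto intro: generate.intros)
    then show ?thesis using that generate_self[of y] square_eq_one_iff[OF that(1)]
      by (auto simp: enhanced_power_graph_simps cyclic_pair_iff)
  qed
  have nonadj: "(u, v) \<notin> parcs (enhanced_power_graph G) \<and> u \<noteq> v"
    if u: "u \<in> {a, inv a}" and v: "v \<in> {x, inv x}" for u v
  proof -
    \<comment> \<open>A cyclic subgroup containing \<open>u\<close> and \<open>v\<close> contains
      \<open>a\<close> and \<open>x\<close>. By maximality of \<open>ord a\<close> it equals
      \<open>generate G {a}\<close>, which omits \<open>x\<close>. The choice \<open>z = u\<close>
      also yields \<open>u \<noteq> v\<close>.\<close>
    have False if z: "z \<in> carrier G" "u \<in> generate G {z}" "v \<in> generate G {z}" for z
    proof -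
      have sub: "subgroup (generate G {z}) G" using z by (simp add: generate_is_subgroup)
      have az: "a \<in> generate G {z}" and xz: "x \<in> generate G {z}"
        using u v z a x(1) subgroup.m_inv_closed[OF sub] by fastforce+
      have "generate G {a} \<subseteq> generate G {z}"
        using az sub by (simp add: generate_subgroup_incl)
      moreover have "card (generate G {z}) \<le> card (generate G {a})"
        using max[OF z(1)] z(1) a by (simp add: generate_pow_card)
      moreover have "finite (generate G {z})"
        using sub fin by (meson finite_subset subgroup.subset)
      ultimately have "generate G {a} = generate G {z}" by (simp add: card_seteq)
      then show False using xz x(2) by simp
    qed
    moreover have "u \<in> carrier G" "v \<in> carrier G" using u v a x by auto
    ultimately show ?thesis using generate_self[of u]
      by (auto simp: enhanced_power_graph_simps cyclic_pair_iff)
  qed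
  have "a \<noteq> inv a" "x \<noteq> inv x"
    using \<open>a \<otimes> a \<noteq> \<one>\<close> a x square_eq_one_iff by metis+
  then have "contains_2K2 (enhanced_power_graph G)"
    unfolding contains_2K2_def
    using nonadj[of a x] nonadj[of a "inv x"] nonadj[of "inv a" x] nonadj[of "inv a" "inv x"]
      self_adj[OF a \<open>a \<otimes> a \<noteq> \<one>\<close>] self_adj[OF x(1,3)]
    by (intro exI[of _ a] exI[of _ "inv a"] exI[of _ x] exI[of _ "inv x"]) simp
  with free show False by blast
qed

end

section \<open>Elementary abelian 2-groups\<close>

text \<open>Every element is its own inverse, and inverting a product reverses its factors.\<close>

lemma (in Group.group) comm_group_if_squares_one:
  assumes sq: "\<And>x. x \<in> carrier G \<Longrightarrow> x \<otimes> x = \<one>"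
  shows "comm_group G"
proof (rule group_comm_groupI)
  fix x y assume xy: "x \<in> carrier G" "y \<in> carrier G"
  have "x \<otimes> y = inv (x \<otimes> y)" "inv x = x" "inv y = y"
    using sq xy square_eq_one_iff by (metis m_closed)+
  then show "x \<otimes> y = y \<otimes> x" using inv_mult_group[OF xy] by simp
qed

text \<open>In place of choosing a basis, a power of the two-element group is embedded into
  \<open>G\<close> with as many factors as possible; maximality makes the embedding onto.\<close>

lemma (in Group.group) elementary_abelian_2_group_if_squares_one:
  assumes fin: "finite (carrier G)" and sq: "\<And>x. x \<in> carrier G \<Longrightarrow> x \<otimes> x = \<one>"
  shows "elementary_abelian_2_group G"
proof -
  interpret comm_group G using sq by (rule comm_group_if_squares_one)
  define E where "E m = product_group {..<m} (\<lambda>_. integer_mod_group 2)" for m :: nat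
  have grp: "group (E m)" for m by (simp add: E_def)
  have carr: "carrier (E m) = (\<Pi>\<^sub>E i\<in>{..<m}. {0, 1})" for m
  proof -
    have "{0..<int 2} = {0, 1}" by auto
    then show ?thesis by (simp add: E_def carrier_integer_mod_group)
  qed
  have mult: "s \<otimes>\<^bsub>E m\<^esub> t = (\<lambda>i\<in>{..<m}. (s i + t i) mod 2)" for s t m by (simp add: E_def)
  have one: "\<one>\<^bsub>E m\<^esub> = (\<lambda>i\<in>{..<m}. 0)" for m by (simp add: E_def)
  have card: "card (carrier (E m)) = 2 ^ m" for m
    by (simp add: carr card_PiE numeral_2_eq_2)
  define P where "P m \<longleftrightarrow> (\<exists>h\<in>hom (E m) G. inj_on h (carrier (E m)))" for m
  have "P 0"
    unfolding P_def by (rule bexI[of _ "\<lambda>_. \<one>"]) (auto simp: carr hom_def)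
  \<comment> \<open>An embedding gives \<open>2 ^ m \<le> card (carrier G)\<close>, which bounds
    \<open>m\<close>, so a largest \<open>m\<close> exists.\<close>
  moreover have "m \<le> card (carrier G)" if "P m" for m
  proof -
    from that obtain h where "h \<in> hom (E m) G" "inj_on h (carrier (E m))" by (auto simp: P_def)
    then have "card (carrier (E m)) \<le> card (carrier G)"
      using fin by (intro card_inj_on_le[of h]) (auto simp: hom_def)
    then show ?thesis using card[of m] less_exp[of m] by linarith
  qed
  ultimately obtain m where m: "P m" and max: "\<And>k. P k \<Longrightarrow> k \<le> m"
    using Greatest_le_nat[of P] GreatestI_nat[of P] by metis
  from m obtain h where h: "h \<in> hom (E m) G" and inj: "inj_on h (carrier (E m))" by (auto simp: P_def)
  have hm: "h (s \<otimes>\<^bsub>E m\<^esub> t) = h s \<otimes> h t" if "s \<in> carrier (E m)" "t \<in> carrier (E m)" for s t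
    using h that by (simp add: hom_def)
  have hc: "h s \<in> carrier G" if "s \<in> carrier (E m)" for s
    using h that by (auto simp: hom_def)
  \<comment> \<open>An element outside the image would extend the embedding of \<open>\<int>\<^sub>2\<^sup>m\<close> to one of \<open>\<int>\<^sub>2\<^sup>m\<^sup>+\<^sup>1\<close>.\<close>
  have "h ` carrier (E m) = carrier G"
  proof (rule ccontr)
    assume "h ` carrier (E m) \<noteq> carrier G"
    then obtain c where c: "c \<in> carrier G" "c \<notin> h ` carrier (E m)" using hc by blast
    let ?r = "\<lambda>s. restrict s {..<m}"
    \<comment> \<open>The new coordinate \<open>m\<close> records whether the factor
      \<open>c\<close> occurs; the others are cut back to \<open>{..<m}\<close> to form an argument
      of \<open>h\<close>.\<close>
    define h' where "h' s = h (?r s) \<otimes> (if s m = 1 then c else \<one>)" for s :: "nat \<Rightarrow> int"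
    have r: "?r s \<in> carrier (E m)" and sm: "s m = 0 \<or> s m = 1" if "s \<in> carrier (E (Suc m))" for s
      using that by (auto simp: carr PiE_iff)
    have "h' (s \<otimes>\<^bsub>E (Suc m)\<^esub> t) = h' s \<otimes> h' t"
      if s: "s \<in> carrier (E (Suc m))" and t: "t \<in> carrier (E (Suc m))" for s t
    proof -
      have "?r (s \<otimes>\<^bsub>E (Suc m)\<^esub> t) = ?r s \<otimes>\<^bsub>E m\<^esub> ?r t" by (auto simp: mult)
      moreover have "(s \<otimes>\<^bsub>E (Suc m)\<^esub> t) m = (s m + t m) mod 2" by (simp add: mult)
      \<comment> \<open>The case of two last coordinates 1: \<open>c \<otimes> c = \<one>\<close>
        matches 1 + 1 = 0 modulo 2.\<close>
      moreover have "h (?r s) \<otimes> c \<otimes> (h (?r t) \<otimes> c) = h (?r s) \<otimes> h (?r t)"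
      proof -
        have "h (?r s) \<otimes> c \<otimes> (h (?r t) \<otimes> c) = h (?r s) \<otimes> h (?r t) \<otimes> (c \<otimes> c)"
          using hc r s t c(1) by (simp add: m_ac)
        then show ?thesis using hc r s t c(1) sq by simp
      qed
      ultimately show ?thesis
        using sm[OF s] sm[OF t] r[OF s] r[OF t] hc c(1)
        by (auto simp: h'_def hm m_ac sq)
    qed
    then have hom: "h' \<in> hom (E (Suc m)) G"
      using r hc c(1) by (auto simp: hom_def h'_def)
    \<comment> \<open>Injectivity through the kernel: a last coordinate 1 would make
      \<open>c\<close>, being its own inverse, a value of \<open>h\<close>.\<close>
    have "s = \<one>\<^bsub>E (Suc m)\<^esub>" if s: "s \<in> carrier (E (Suc m))" and "h' s = \<one>" for s
    proof -
      have "s m = 0"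
      proof (rule ccontr)
        assume "s m \<noteq> 0"
        then have "h (?r s) \<otimes> c = \<one>" using sm[OF s] \<open>h' s = \<one>\<close> by (simp add: h'_def)
        then have "inv c = h (?r s)" using hc r[OF s] c(1) by (intro inv_equality) auto
        then have "c = h (?r s)" using sq c(1) by (simp add: square_eq_one_iff)
        then show False using c(2) r[OF s] by blast
      qed
      then have "h (?r s) = \<one>" using \<open>h' s = \<one>\<close> hc r[OF s] by (simp add: h'_def)
      then have "?r s = \<one>\<^bsub>E m\<^esub>"
        using inj_on_one_iff'[OF h grp is_group] inj r[OF s] by blast
      then have "s i = 0" if "i < m" for i
        using that by (metis lessThan_iff one restrict_apply')
      then show ?thesis
        using s \<open>s m = 0\<close> by (auto simp: one carr PiE_iff extensional_def fun_eq_iff less_Suc_eq)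
    qed
    then have "inj_on h' (carrier (E (Suc m)))"
      using inj_on_one_iff'[OF hom grp is_group] by blast
    with hom have "P (Suc m)" by (auto simp: P_def)
    then show False using max by fastforce
  qed
  then have "E m \<cong> G"
    using h inj by (intro is_isoI) (auto simp: iso_def bij_betw_def)
  then have "G \<cong> E m" by (rule group.iso_sym[OF grp])
  then show ?thesis unfolding elementary_abelian_2_group_def E_def by blast
qed

lemma elementary_abelian_2_group_squares_one:
  assumes "Group.group G" "elementary_abelian_2_group G" "x \<in> carrier G"
  shows "x \<otimes>\<^bsub>G\<^esub> x = \<one>\<^bsub>G\<^esub>"
proof -
  interpret G: Group.group G by fact
  obtain m h where h: "h \<in> iso G (product_group {..<m::nat} (\<lambda>_. integer_mod_group 2))" (is "_ \<in> iso G ?E")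
    using assms(2) by (auto simp: elementary_abelian_2_group_def is_iso_def)
  have grp: "group ?E" by simp
  have hom: "h \<in> hom G ?E" and inj: "inj_on h (carrier G)"
    using h by (auto simp: iso_def bij_betw_def)
  have "h x \<in> carrier ?E" using hom assms(3) by (auto simp: hom_def)
  then have "h x i \<in> {0..<2}" if "i < m" for i
    using that by (auto simp: carrier_integer_mod_group PiE_iff)
  then have "h x i = 0 \<or> h x i = 1" if "i < m" for i
    using that by fastforce
  then have "h x \<otimes>\<^bsub>?E\<^esub> h x = \<one>\<^bsub>?E\<^esub>" by (fastforce simp: fun_eq_iff)
  then have "h (x \<otimes>\<^bsub>G\<^esub> x) = \<one>\<^bsub>?E\<^esub>" using hom assms(3) by (simp add: hom_def)
  then show ?thesis
    using inj_on_one_iff'[OF hom G.is_group grp] inj assms(3) by (metis G.m_closed)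
qed

section \<open>Presented and dihedral groups\<close>

text \<open>The extension of \<open>g\<close> from generators to words; its compatibility with
  \<open>word_cong\<close> yields maps out of presented groups.\<close>

primrec eval_word :: "('a, 'b) monoid_scheme \<Rightarrow> ('x \<Rightarrow> 'a) \<Rightarrow> 'x group_word \<Rightarrow> 'a" where
  "eval_word G g [] = \<one>\<^bsub>G\<^esub>"
| "eval_word G g (l # w) = (if snd l then g (fst l) else inv\<^bsub>G\<^esub> g (fst l)) \<otimes>\<^bsub>G\<^esub> eval_word G g w"

context Group.group
begin

lemma eval_word_closed [simp]: "range g \<subseteq> carrier G \<Longrightarrow> eval_word G g w \<in> carrier G"
  by (induction w) auto

lemma eval_word_append:
  "range g \<subseteq> carrier G \<Longrightarrow> eval_word G g (u @ v) = eval_word G g u \<otimes> eval_word G g v"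
  by (induction u) (auto simp: m_assoc image_subset_iff)

lemma eval_word_replicate:
  "range g \<subseteq> carrier G \<Longrightarrow> eval_word G g (replicate n (x, True)) = g x [^] n"
proof (induction n)
  case (Suc n)
  then have "g x \<in> carrier G" by auto
  then show ?case using Suc nat_pow_Suc2[of "g x" n] by simp
qed simp

lemma eval_word_cong:
  assumes g: "range g \<subseteq> carrier G"
    and R: "\<And>u v. (u, v) \<in> R \<Longrightarrow> eval_word G g u = eval_word G g v"
    and "word_cong R u v"
  shows "eval_word G g u = eval_word G g v"
  using assms(3)
proof induction
  case (append u u' v v')
  then show ?case by (simp add: eval_word_append[OF g])
next
  case (cancel x s)
  have "g x \<in> carrier G" using g by auto
  then show ?case by simp
next
  case (relation u v)
  then show ?case by (rule R)
qed simp_all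

text \<open>Von Dyck's theorem, the universal property of a presentation.\<close>

lemma presented_group_hom:
  assumes g: "range g \<subseteq> carrier G"
    and R: "\<And>u v. (u, v) \<in> R \<Longrightarrow> eval_word G g u = eval_word G g v"
  obtains h where "h \<in> hom (presented_group R) G" "\<And>w. h (word_class R w) = eval_word G g w"
proof
  \<comment> \<open>By \<open>eval_word_cong\<close> the word picked from a class does not affect
    the value.\<close>
  define h where "h X = eval_word G g (SOME w. w \<in> X)" for X
  show eval: "h (word_class R w) = eval_word G g w" for w
  proof -
    have "w \<in> word_class R w" by (simp add: word_class_def word_cong.refl)
    then have "(SOME v. v \<in> word_class R w) \<in> word_class R w" by (rule someI)
    then show ?thesis
      unfolding h_def using eval_word_cong[OF g R] by (simp add: word_class_def)
  qed
  show "h \<in> hom (presented_group R) G"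
  proof (rule homI)
    fix X Y assume "X \<in> carrier (presented_group R)" "Y \<in> carrier (presented_group R)"
    then obtain u v where "X = word_class R u" "Y = word_class R v"
      by (auto simp: presented_group_def)
    then show "h X \<in> carrier G" "h (X \<otimes>\<^bsub>presented_group R\<^esub> Y) = h X \<otimes> h Y"
      using g by (simp_all add: mult_presented_group eval eval_word_append)
  qed
qed

text \<open>Since \<open>b \<otimes> a = inv a \<otimes> b\<close>, moving \<open>b\<close> across a
  power inverts it factor by factor.\<close>

lemma conj_involution_int_pow:
  assumes a: "a \<in> carrier G" and b: "b \<in> carrier G"
    and bb: "b \<otimes> b = \<one>" and bab: "b \<otimes> a \<otimes> b = inv a"
  shows "b \<otimes> a [^] (i::int) = a [^] (- i) \<otimes> b"
proof -
  \<comment> \<open>Stated for a fresh \<open>a\<close>, so that it also applies to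
    \<open>inv a\<close> and thereby settles negative exponents.\<close>
  have nat: "b \<otimes> a [^] (k::nat) = inv (a [^] k) \<otimes> b" if "a \<in> carrier G" "b \<otimes> a = inv a \<otimes> b" for a k
  proof (induction k)
    case 0
    then show ?case using b by simp
  next
    case (Suc k)
    have "b \<otimes> a [^] Suc k = inv (a [^] k) \<otimes> (b \<otimes> a)"
      using Suc that(1) b by (simp flip: m_assoc)
    also have "\<dots> = inv (a [^] k) \<otimes> inv a \<otimes> b"
      using that b by (simp add: m_assoc)
    also have "inv (a [^] k) \<otimes> inv a = inv (a [^] Suc k)"
      using that(1) by (simp only: nat_pow_Suc2 inv_mult_group nat_pow_closed)
    finally show ?case .
  qed
  have ba: "b \<otimes> a = inv a \<otimes> b"
  proof -
    have "b \<otimes> a = b \<otimes> a \<otimes> (b \<otimes> b)" using a b bb by simp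
    also have "\<dots> = b \<otimes> a \<otimes> b \<otimes> b" using a b by (simp only: m_assoc m_closed)
    finally show ?thesis using bab by simp
  qed
  have bia: "b \<otimes> inv a = inv (inv a) \<otimes> b"
  proof -
    have "b \<otimes> inv a = b \<otimes> (b \<otimes> a \<otimes> b)" using bab by simp
    also have "\<dots> = (b \<otimes> b) \<otimes> (a \<otimes> b)" using a b by (simp only: m_assoc m_closed)
    finally show ?thesis using a b bb by simp
  qed
  show ?thesis
    using nat[OF a ba] nat[OF inv_closed[OF a] bia] a
    by (cases i rule: int_cases2) (simp_all add: int_pow_neg int_pow_int nat_pow_inv)
qed

text \<open>Moving the first \<open>b\<close> across the second power of \<open>a\<close> makes the
  two powers cancel, and \<open>b \<otimes> b\<close> remains.\<close>

lemma reflection_square: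
  assumes a: "a \<in> carrier G" and b: "b \<in> carrier G"
    and bb: "b \<otimes> b = \<one>" and bab: "b \<otimes> a \<otimes> b = inv a"
  shows "(a [^] (i::int) \<otimes> b) \<otimes> (a [^] i \<otimes> b) = \<one>"
proof -
  have "(a [^] i \<otimes> b) \<otimes> (a [^] i \<otimes> b) = a [^] i \<otimes> (b \<otimes> a [^] i) \<otimes> b"
    using a b by (simp add: m_assoc)
  also have "\<dots> = (a [^] i \<otimes> a [^] (- i)) \<otimes> (b \<otimes> b)"
    unfolding conj_involution_int_pow[OF assms] using a b by (simp add: m_assoc)
  finally show ?thesis using a bb by (simp flip: int_pow_mult)
qed

end

section \<open>Generators and normal form of the dihedral presentation\<close>

abbreviation "dihedral_a n \<equiv> word_class (dihedral_relations n) [(gen_a, True)]"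
abbreviation "dihedral_b n \<equiv> word_class (dihedral_relations n) [(gen_b, True)]"

lemma group_dihedral_group: "Group.group (dihedral_group n)"
  unfolding dihedral_group_def by (rule group_presented_group)

lemma word_class_in_presented_group: "word_class R w \<in> carrier (presented_group R)"
  by (simp add: presented_group_def)

lemma one_presented_group: "\<one>\<^bsub>presented_group R\<^esub> = word_class R []"
  by (simp add: presented_group_def)

lemma inv_presented_group_letter:
  "inv\<^bsub>presented_group R\<^esub> (word_class R [(x, True)]) = word_class R [(x, False)]"
  using word_cong.cancel[of R x False]
  by (intro group.inv_equality[OF group_presented_group])
    (simp_all add: mult_presented_group one_presented_group word_class_eq_iff word_class_in_presented_group)

lemma pow_presented_group_letter:
  "word_class R [l] [^]\<^bsub>presented_group R\<^esub> (k::nat) = word_class R (replicate k l)"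
proof (induction k)
  case 0
  then show ?case by (simp add: one_presented_group)
next
  case (Suc k)
  then show ?case by (simp add: mult_presented_group replicate_append_same)
qed

lemma dihedral_group_generators:
  "dihedral_a n \<in> carrier (dihedral_group n)" "dihedral_b n \<in> carrier (dihedral_group n)"
  by (simp_all add: dihedral_group_def word_class_in_presented_group)

lemma dihedral_group_relations:
  shows "dihedral_a n [^]\<^bsub>dihedral_group n\<^esub> n = \<one>\<^bsub>dihedral_group n\<^esub>"
    and "dihedral_b n \<otimes>\<^bsub>dihedral_group n\<^esub> dihedral_b n = \<one>\<^bsub>dihedral_group n\<^esub>"
    and "dihedral_b n \<otimes>\<^bsub>dihedral_group n\<^esub> dihedral_a n \<otimes>\<^bsub>dihedral_group n\<^esub> dihedral_b n
           = inv\<^bsub>dihedral_group n\<^esub> dihedral_a n"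
  unfolding dihedral_group_def
  by (simp_all add: pow_presented_group_letter mult_presented_group one_presented_group
      inv_presented_group_letter word_class_eq_iff word_cong.relation dihedral_relations_def)

text \<open>The set \<open>N\<close> of these forms contains the identity and is closed under left
  multiplication by \<open>?a\<close>, its inverse and \<open>?b\<close>, so induction over words
  reaches every class. Uniqueness of the form is not claimed.\<close>

lemma dihedral_group_normal_form:
  assumes "X \<in> carrier (dihedral_group n)"
  obtains i :: int where "X = dihedral_a n [^]\<^bsub>dihedral_group n\<^esub> i"
  | i :: int where "X = dihedral_a n [^]\<^bsub>dihedral_group n\<^esub> i \<otimes>\<^bsub>dihedral_group n\<^esub> dihedral_b n"
proof -
  let ?D = "dihedral_group n" and ?a = "dihedral_a n" and ?b = "dihedral_b n"
  interpret D: Group.group ?D by (rule group_dihedral_group)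
  note gen = dihedral_group_generators[of n]
  note rel = dihedral_group_relations[of n]
  note conj = D.conj_involution_int_pow[OF gen rel(2,3)]
  define N where "N = range (\<lambda>i::int. ?a [^]\<^bsub>?D\<^esub> i) \<union> range (\<lambda>i::int. ?a [^]\<^bsub>?D\<^esub> i \<otimes>\<^bsub>?D\<^esub> ?b)"
  have a_mult: "?a [^]\<^bsub>?D\<^esub> j \<otimes>\<^bsub>?D\<^esub> Y \<in> N" if "Y \<in> N" for Y and j :: int
    using that gen by (auto simp: N_def simp flip: D.m_assoc D.int_pow_mult)
  have b_mult: "?b \<otimes>\<^bsub>?D\<^esub> Y \<in> N" if "Y \<in> N" for Y
  proof -
    have "?b \<otimes>\<^bsub>?D\<^esub> (?a [^]\<^bsub>?D\<^esub> i \<otimes>\<^bsub>?D\<^esub> ?b) = ?a [^]\<^bsub>?D\<^esub> (- i)" for i :: int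
    proof -
      have "?b \<otimes>\<^bsub>?D\<^esub> (?a [^]\<^bsub>?D\<^esub> i \<otimes>\<^bsub>?D\<^esub> ?b) = ?a [^]\<^bsub>?D\<^esub> (- i) \<otimes>\<^bsub>?D\<^esub> (?b \<otimes>\<^bsub>?D\<^esub> ?b)"
        using gen conj[of i] by (metis D.int_pow_closed D.m_assoc)
      then show ?thesis using gen rel(2) by simp
    qed
    then show ?thesis using that conj by (auto simp: N_def)
  qed
  have inv_b: "inv\<^bsub>?D\<^esub> ?b = ?b" using rel(2) gen by (intro D.inv_equality) auto
  have "word_class (dihedral_relations n) w \<in> N" for w
  proof (induction w)
    case Nil
    have "word_class (dihedral_relations n) [] = ?a [^]\<^bsub>?D\<^esub> (0::int)"
      by (simp add: dihedral_group_def one_presented_group)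
    then show ?case unfolding N_def by blast
  next
    case (Cons l w)
    have cons: "word_class (dihedral_relations n) (l # w) =
        word_class (dihedral_relations n) [l] \<otimes>\<^bsub>?D\<^esub> word_class (dihedral_relations n) w"
      by (simp add: dihedral_group_def mult_presented_group)
    obtain x s where l: "l = (x, s)" by fastforce
    have "word_class (dihedral_relations n) [l] \<in> {?a [^]\<^bsub>?D\<^esub> (1::int), ?a [^]\<^bsub>?D\<^esub> (- 1::int), ?b}"
    proof (cases s)
      case True
      then show ?thesis using l gen by (cases x) auto
    next
      case False
      then have "word_class (dihedral_relations n) [l] = inv\<^bsub>?D\<^esub> (word_class (dihedral_relations n) [(x, True)])"
        by (simp add: l dihedral_group_def inv_presented_group_letter)
      then show ?thesis using gen inv_b by (cases x) (auto simp: D.int_pow_neg)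
    qed
    then show ?case 
      unfolding cons using a_mult[OF Cons.IH, of 1] a_mult[OF Cons.IH, of "- 1"] b_mult[OF Cons.IH] by auto
  qed
  then have "X \<in> N" using assms by (auto simp: dihedral_group_def presented_group_def)
  then show ?thesis using that by (auto simp: N_def)
qed

section \<open>Classification of the groups satisfying the pivotal condition\<close>

context Group.group
begin

text \<open>The cyclic subgroup is that of the rotations; reflections square to the identity by
  \<open>reflection_square\<close>.\<close>

lemma involutive_off_cyclic_if_dihedral:
  assumes dih: "is_dihedral_group G"
  shows "involutive_off_cyclic G"
proof -
  obtain n where "G \<cong> dihedral_group n" using dih by (auto simp: is_dihedral_group_def)
  then have "dihedral_group n \<cong> G" by (rule iso_sym)
  then obtain h where h: "h \<in> iso (dihedral_group n) G" by (auto simp: is_iso_def)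
  let ?D = "dihedral_group n"
  interpret D: Group.group ?D by (rule group_dihedral_group)
  note gen = dihedral_group_generators[of n]
  note rel = dihedral_group_relations[of n]
  have hom: "h \<in> hom ?D G" and surj: "h ` carrier ?D = carrier G"
    using h by (auto simp: iso_def bij_betw_def)
  interpret h: group_hom ?D G h by unfold_locales (rule hom)
  have "x \<in> generate G {h (dihedral_a n)} \<or> x \<otimes> x = \<one>" if "x \<in> carrier G" for x
  proof -
    have "x \<in> h ` carrier ?D" using that surj by simp
    then obtain X where x: "x = h X" and X: "X \<in> carrier ?D" by (rule imageE)
    from X show ?thesis
    proof (cases rule: dihedral_group_normal_form)
      case (1 i)
      then have "x = h (dihedral_a n) [^] i" using x gen by (simp add: h.hom_int_pow)
      then show ?thesis using gen by (simp add: generate_singleton)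
    next
      case (2 i)
      then have "X \<otimes>\<^bsub>?D\<^esub> X = \<one>\<^bsub>?D\<^esub>" using D.reflection_square[OF gen rel(2,3)] by simp
      then have "x \<otimes> x = \<one>" using X x by (metis h.hom_mult h.hom_one)
      then show ?thesis by simp
    qed
  qed
  then show ?thesis
    unfolding involutive_off_cyclic_def using gen(1) h.hom_closed by blast
qed

text \<open>The presentation with index \<open>ord a\<close> maps to \<open>G\<close> by
  \<open>presented_group_hom\<close>. The map is onto by \<open>cover\<close>, and its kernel is
  seen to be trivial on normal forms.\<close>

lemma is_dihedral_groupI:
  assumes a: "a \<in> carrier G" and b: "b \<in> carrier G" "b \<notin> generate G {a}"
    and bb: "b \<otimes> b = \<one>" and bab: "b \<otimes> a \<otimes> b = inv a" and ord: "ord a \<noteq> 0"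
    and cover: "\<And>x. x \<in> carrier G \<Longrightarrow> x \<otimes> b \<in> generate G {a} \<or> x \<in> generate G {a}"
  shows "is_dihedral_group G"
proof -
  let ?n = "ord a"
  let ?D = "dihedral_group ?n"
  interpret D: Group.group ?D by (rule group_dihedral_group)
  note gen = dihedral_group_generators[of ?n]
  note rel = dihedral_group_relations[of ?n]
  define g where "g x = (case x of gen_a \<Rightarrow> a | gen_b \<Rightarrow> b)" for x
  have g: "range g \<subseteq> carrier G" using a b by (auto simp: g_def split: dihedral_generator.splits)
  have g_simps [simp]: "g gen_a = a" "g gen_b = b" by (simp_all add: g_def)
  have "eval_word G g u = eval_word G g v" if "(u, v) \<in> dihedral_relations ?n" for u v
    using that a b bb bab
    by (auto simp: dihedral_relations_def eval_word_replicate[OF g] m_assoc)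
  then obtain h where hom: "h \<in> hom ?D G"
    and h: "\<And>w. h (word_class (dihedral_relations ?n) w) = eval_word G g w"
    using presented_group_hom[OF g, of "dihedral_relations ?n"] unfolding dihedral_group_def by metis
  interpret h: group_hom ?D G h by unfold_locales (rule hom)
  have ha: "h (dihedral_a ?n) = a" and hb: "h (dihedral_b ?n) = b" using a b by (simp_all add: h)
  have pow: "h (dihedral_a ?n [^]\<^bsub>?D\<^esub> i) = a [^] i" for i :: int
    using gen by (simp add: h.hom_int_pow ha)
  have "inj_on h (carrier ?D)"
    unfolding h.inj_on_one_iff
  proof (intro allI impI)
    fix X assume X: "X \<in> carrier ?D" and 1: "h X = \<one>"
    from X show "X = \<one>\<^bsub>?D\<^esub>"
    proof (cases rule: dihedral_group_normal_form)
      case (1 i)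
      \<comment> \<open>The exponent of a rotation in the kernel is a multiple of
        \<open>ord a\<close>, so the rotation is already trivial in \<open>?D\<close> by the first
        relation.\<close>
      then have "int ?n dvd i" using \<open>h X = \<one>\<close> a by (simp add: pow int_pow_eq_id)
      then obtain k where "i = int ?n * k" by blast
      then have "X = (dihedral_a ?n [^]\<^bsub>?D\<^esub> ?n) [^]\<^bsub>?D\<^esub> k"
        using 1 gen by (simp add: D.int_pow_pow flip: int_pow_int)
      then show ?thesis by (simp add: rel(1))
    next
      case (2 i)
      \<comment> \<open>A reflection in the kernel would put \<open>b\<close> into
        \<open>generate G {a}\<close>.\<close>
      then have "a [^] i \<otimes> b = \<one>" using \<open>h X = \<one>\<close> gen by (simp add: pow hb)
      then have "b = inv (a [^] i)" using a b inv_equality inv_inv by (metis int_pow_closed)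
      then have "b = a [^] (- i)" using a by (simp add: int_pow_neg)
      then show ?thesis using a b(2) by (simp add: generate_singleton)
    qed
  qed
  moreover have "x \<in> h ` carrier ?D" if x: "x \<in> carrier G" for x
    using cover[OF x]
  proof
    assume "x \<in> generate G {a}"
    then obtain i :: int where "x = a [^] i" using a by (auto simp: generate_singleton)
    then have "x = h (dihedral_a ?n [^]\<^bsub>?D\<^esub> i)" by (simp add: pow)
    then show ?thesis using gen by blast
  next
    assume "x \<otimes> b \<in> generate G {a}"
    then obtain i :: int where "x \<otimes> b = a [^] i" using a by (auto simp: generate_singleton)
    then have "x = a [^] i \<otimes> b" using x b bb by (metis m_assoc r_one)
    then have "x = h (dihedral_a ?n [^]\<^bsub>?D\<^esub> i \<otimes>\<^bsub>?D\<^esub> dihedral_b ?n)"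
      using gen by (simp add: pow hb)
    then show ?thesis using gen by blast
  qed
  moreover have "h X \<in> carrier G" if "X \<in> carrier ?D" for X using that by simp
  ultimately have "?D \<cong> G" using hom by (intro is_isoI[of h]) (auto simp: iso_def bij_betw_def)
  then have "G \<cong> ?D" by (rule D.iso_sym)
  \<comment> \<open>\<open>ord a \<noteq> 0\<close> gives an index of at least 1, as index 0 would
    mean the infinite dihedral group.\<close>
  then show ?thesis unfolding is_dihedral_group_def using ord by (intro exI[of _ ?n]) simp
qed

lemma involutive_off_cyclic_iff:
  assumes fin: "finite (carrier G)"
  shows "involutive_off_cyclic G \<longleftrightarrow>
    cyclic_group G \<or> is_dihedral_group G \<or> elementary_abelian_2_group G"
proof
  assume "involutive_off_cyclic G"
  then obtain a where a: "a \<in> carrier G"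
    and off: "\<And>x. x \<in> carrier G \<Longrightarrow> x \<notin> generate G {a} \<Longrightarrow> x \<otimes> x = \<one>"
    unfolding involutive_off_cyclic_def by blast
  let ?A = "generate G {a}"
  have sub: "subgroup ?A G" using a by (simp add: generate_is_subgroup)
  show "cyclic_group G \<or> is_dihedral_group G \<or> elementary_abelian_2_group G"
  proof (cases "a \<otimes> a = \<one>")
    case True
    \<comment> \<open>Here \<open>?A\<close> is \<open>{\<one>, a}\<close>, so its elements square
      to \<open>\<one>\<close> like all the others.\<close>
    have "x \<otimes> x = \<one>" if "x \<in> carrier G" for x
      using off[OF that] generate_involution[OF a True] True by (cases "x \<in> ?A") auto
    then show ?thesis using elementary_abelian_2_group_if_squares_one fin by blast
  next
    case aa: False
    show ?thesis
    proof (cases "carrier G = ?A")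
      case True
      then have "cyclic_group G"
        unfolding cyclic_group generate_singleton[OF a] using a by blast
      then show ?thesis by simp
    next
      case False
      then obtain b where b: "b \<in> carrier G" "b \<notin> ?A" using subgroup.subset[OF sub] by blast
      \<comment> \<open>With \<open>x\<close>, also \<open>x \<otimes> a\<close> lies outside
        \<open>?A\<close>; that it squares to \<open>\<one>\<close> says that
        \<open>x \<otimes> a \<otimes> x\<close> is the inverse of \<open>a\<close>.\<close>
      have inverts: "x \<otimes> a \<otimes> x = inv a" if x: "x \<in> carrier G" "x \<notin> ?A" for x
      proof -
        have "x \<otimes> a \<notin> ?A"
        proof
          assume "x \<otimes> a \<in> ?A"
          then have "x \<otimes> a \<otimes> inv a \<in> ?A"
            by (rule subgroup.m_closed[OF sub _ subgroup.m_inv_closed[OF sub generate_self(1)]])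
          then show False using x a by (simp add: m_assoc)
        qed
        then have "(x \<otimes> a) \<otimes> (x \<otimes> a) = \<one>" using off x a by simp
        then have "(x \<otimes> a \<otimes> x) \<otimes> a = \<one>" using x a by (simp add: m_assoc)
        then show ?thesis using x a by (intro inv_equality[symmetric]) auto
      qed
      have cover: "x \<otimes> b \<in> ?A \<or> x \<in> ?A" if x: "x \<in> carrier G" for x
      proof (rule ccontr)
        assume "\<not> (x \<otimes> b \<in> ?A \<or> x \<in> ?A)"
        then have xb: "x \<otimes> b \<notin> ?A" "x \<notin> ?A" by auto
        \<comment> \<open>All of \<open>x\<close>, \<open>b\<close> and \<open>x \<otimes> b\<close>
          lie outside \<open>?A\<close>, so moving \<open>a\<close> across each of them inverts it.
          Across \<open>x \<otimes> b\<close> this happens once, across \<open>b\<close> and then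
          \<open>x\<close> twice, which forces \<open>inv a = a\<close>.\<close>
        have conj: "y \<otimes> a = inv a \<otimes> y" if y: "y \<in> carrier G" "y \<notin> ?A" for y
        proof -
          have "y \<otimes> a = y \<otimes> a \<otimes> y \<otimes> y" using off[OF y] y(1) a by (simp add: m_assoc)
          then show ?thesis using inverts[OF y] by simp
        qed
        have "inv a \<otimes> (x \<otimes> b) = x \<otimes> (b \<otimes> a)"
          using conj[of "x \<otimes> b"] xb x b a by (simp add: m_assoc)
        also have "\<dots> = x \<otimes> inv a \<otimes> b"
          unfolding conj[OF b] using x a b by (simp add: m_assoc)
        also have "x \<otimes> inv a = a \<otimes> x"
        proof -
          have "a \<otimes> (x \<otimes> a) = x" unfolding conj[OF x xb(2)] using x a by (simp flip: m_assoc)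
          then have "a \<otimes> x \<otimes> a \<otimes> inv a = x \<otimes> inv a" using x a by (simp add: m_assoc)
          then show ?thesis using x a by (simp add: m_assoc)
        qed
        finally have "inv a \<otimes> (x \<otimes> b) = a \<otimes> (x \<otimes> b)" using x a b by (simp add: m_assoc)
        then have "inv a = a" using x a b by simp
        then show False using aa a by (simp add: square_eq_one_iff)
      qed
      have "ord a \<noteq> 0" using ord_ge_1[OF fin a] by simp
      then have "is_dihedral_group G"
        using is_dihedral_groupI[OF a b off[OF b] inverts[OF b]] cover by blast
      then show ?thesis by simp
    qed
  qed
next
  assume "cyclic_group G \<or> is_dihedral_group G \<or> elementary_abelian_2_group G"
  then consider "cyclic_group G" | "is_dihedral_group G" | "elementary_abelian_2_group G" by blast
  then show "involutive_off_cyclic G"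
  proof cases
    case 1
    then show ?thesis unfolding cyclic_group involutive_off_cyclic_def
      by (auto simp: generate_singleton)
  next
    case 2
    then show ?thesis by (rule involutive_off_cyclic_if_dihedral)
  next
    case 3
    then show ?thesis
      using elementary_abelian_2_group_squares_one[OF is_group] by (auto simp: involutive_off_cyclic_def)
  qed
qed

end

theorem theorem3p3:
  fixes G :: "('a, 'b) monoid_scheme"
  assumes "Group.group G" and "finite (carrier G)"
  shows "(split_graph (enhanced_power_graph G) \<longleftrightarrow> threshold_graph (enhanced_power_graph G))
    \<and> (threshold_graph (enhanced_power_graph G) \<longleftrightarrow> graph_free (enhanced_power_graph G) two_K2)
    \<and> (graph_free (enhanced_power_graph G) two_K2 \<longleftrightarrow>
         cyclic_group G \<or> is_dihedral_group G \<or> elementary_abelian_2_group G)"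
proof -
  interpret Group.group G by fact
  note P = pair_graph_enhanced_power_graph[OF assms(2)]
  \<comment> \<open>Both graph classes exclude \<open>two_K2\<close>, its absence gives
    \<open>involutive_off_cyclic\<close>, and that condition gives both classes back. The list of
    groups enters by being rewritten to the same condition.\<close>
  show ?thesis
    using split_graph_no_2K2[OF P] threshold_graph_no_2K2 involutive_off_cyclic_if_no_2K2[OF assms(2)]
      split_threshold_if_involutive_off_cyclic[OF assms(2)]
    unfolding graph_free_two_K2_iff[OF P] involutive_off_cyclic_iff[OF assms(2), symmetric]
    by blast
qed

end
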